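(* For every integer $n\ge 7$ with $n\equiv 3 \pmod 4$, there exists in $E^n$ a mobile set that is both irreducible (not reducible) and indivisible.
   Context: $E^n$ denotes the set of binary words of length $n$ with the Hamming metric $d$; $e_i$ is the word with a single $1$ in coordinate $i$; $|x|$ denotes the sum of the coordinates of $x$ modulo $2$. A set $M\subseteq E^n$ is a $1$-code if the balls of radius $1$ centered at distinct elements of $M$ are pairwise disjoint. The neighborhood of $M$ is $\Omega(M)=\{x\in E^n: d(x,M)\le 1\}$, and $\Omega^*(M)=\Omega(M)\setminus M$. A set $M\subseteq E^n$ is a mobile set if it is a $1$-code and there is a $1$-code $M'\subseteq E^n$ with $M\cap M'=\emptyset$ and $\Omega(M)=\Omega(M')$; such $M'$ is called an alternative of $M$. A nonempty mobile set is divisible if it can be represented as the union of two nonempty mobile sets, and indivisible otherwise. The extension of $M\subseteq E^n$ is the set $\{(x,|x|):x\in M\}\subseteq E^{n+1}$ or $\{(x,|x|\oplus 1):x\in M\}\subseteq E^{n+1}$ (appending a parity or an odd-parity check). An extended mobile set is a set obtained as the extension of a mobile set. For an extended mobile set $M\subseteq E^m$ and a disjoint set $M'\subseteq E^m$ of $1$-code words of the same parity as those of $M$ with $\Omega^*(M)=\Omega^*(M')$ (an alternative of $M$), one forms $R=\{(x,0,0):x\in M\}\cup\{(x,1,1):x\in M'\}\subseteq E^{m+2}$. An extended mobile set in $E^{m+2}$ is called reducible if it can be obtained by this construction from some extended mobile set and its alternative in $E^m$, followed by a permutation of coordinates and inversion of some coordinates applied simultaneously to all words of the set. A mobile set is reducible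 if its corresponding extended mobile set is reducible.
   Formalization: "Divisible" is taken to mean a union of two disjoint nonempty mobile sets; without disjointness, M = M ∪ M would make every nonempty mobile set divisible and the claim false. *)

theory Defs
  imports Main "HOL-Library.Z2" "HOL-Library.Disjoint_Sets" "HOL-Combinatorics.Permutations"
begin

text \<open>Words are lists over the two-element field \<^typ>\<open>bit\<close>, so that \<open>sum_list x\<close> is the sum of the
  coordinates of \<open>x\<close> modulo 2, and adding \<open>1\<close> to a coordinate inverts it.\<close>

definition words :: "nat \<Rightarrow> bit list set" where
  "words n = {x. length x = n}"

definition hdist :: "bit list \<Rightarrow> bit list \<Rightarrow> nat" where
  "hdist x y = card {i. i < length x \<and> x ! i \<noteq> y ! i}"

definition hball :: "nat \<Rightarrow> bit list \<Rightarrow> bit list set" where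
  "hball n x = {y \<in> words n. hdist x y \<le> 1}"

definition one_code :: "nat \<Rightarrow> bit list set \<Rightarrow> bool" where
  "one_code n M \<longleftrightarrow> M \<subseteq> words n \<and> disjoint_family_on (hball n) M"

definition nbhd :: "nat \<Rightarrow> bit list set \<Rightarrow> bit list set" where
  "nbhd n M = {x \<in> words n. \<exists>y\<in>M. hdist x y \<le> 1}"

definition punctured_nbhd :: "nat \<Rightarrow> bit list set \<Rightarrow> bit list set" where
  "punctured_nbhd n M = nbhd n M - M"

definition alternative :: "nat \<Rightarrow> bit list set \<Rightarrow> bit list set \<Rightarrow> bool" where
  "alternative n M M' \<longleftrightarrow> one_code n M' \<and> M \<inter> M' = {} \<and> nbhd n M = nbhd n M'"

definition mobile :: "nat \<Rightarrow> bit list set \<Rightarrow> bool" where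
  "mobile n M \<longleftrightarrow> one_code n M \<and> (\<exists>M'. alternative n M M')"

text \<open>The two parts are required to be disjoint: if they could overlap arbitrarily, then
  \<open>M = M \<union> M\<close> would make every nonempty mobile set divisible.\<close>

definition divisible :: "nat \<Rightarrow> bit list set \<Rightarrow> bool" where
  "divisible n M \<longleftrightarrow> mobile n M \<and> M \<noteq> {} \<and>
     (\<exists>A B. mobile n A \<and> A \<noteq> {} \<and> mobile n B \<and> B \<noteq> {} \<and> A \<inter> B = {} \<and> M = A \<union> B)"

definition indivisible :: "nat \<Rightarrow> bit list set \<Rightarrow> bool" where
  "indivisible n M \<longleftrightarrow> mobile n M \<and> M \<noteq> {} \<and> \<not> divisible n M"

text \<open>The parity check is appended for \<open>b = 0\<close>, the odd-parity check for \<open>b = 1\<close>.\<close>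

definition extension :: "bit \<Rightarrow> bit list set \<Rightarrow> bit list set" where
  "extension b M = (\<lambda>x. x @ [sum_list x + b]) ` M"

definition ext_mobile :: "nat \<Rightarrow> bit list set \<Rightarrow> bool" where
  "ext_mobile m S \<longleftrightarrow> (\<exists>n M b. m = n + 1 \<and> mobile n M \<and> S = extension b M)"

definition ext_alternative :: "nat \<Rightarrow> bit list set \<Rightarrow> bit list set \<Rightarrow> bool" where
  "ext_alternative m M M' \<longleftrightarrow> one_code m M' \<and> M \<inter> M' = {} \<and>
     (\<forall>x\<in>M. \<forall>y\<in>M'. sum_list x = sum_list y) \<and>
     punctured_nbhd m M = punctured_nbhd m M'"

definition doubling :: "bit list set \<Rightarrow> bit list set \<Rightarrow> bit list set" where
  "doubling M M' = (\<lambda>x. x @ [0, 0]) ` M \<union> (\<lambda>x. x @ [1, 1]) ` M'"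

text \<open>Permute the coordinates by \<open>p\<close>, then invert those where \<open>z\<close> has a \<open>1\<close>.\<close>

definition permute_invert :: "(nat \<Rightarrow> nat) \<Rightarrow> bit list \<Rightarrow> bit list \<Rightarrow> bit list" where
  "permute_invert p z x = map (\<lambda>i. x ! p i + z ! i) [0..<length x]"

definition ext_reducible :: "nat \<Rightarrow> bit list set \<Rightarrow> bool" where
  "ext_reducible k S \<longleftrightarrow> ext_mobile k S \<and>
     (\<exists>m M M' p z. k = m + 2 \<and> ext_mobile m M \<and> ext_alternative m M M' \<and>
        p permutes {..<k} \<and> z \<in> words k \<and> S = permute_invert p z ` doubling M M')"

text \<open>The two extensions of \<open>M\<close> differ by inverting the last coordinate, so it does not matter
  which of them is taken as the one corresponding to \<open>M\<close>.\<close>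

definition reducible :: "nat \<Rightarrow> bit list set \<Rightarrow> bool" where
  "reducible n M \<longleftrightarrow> mobile n M \<and> (\<exists>b. ext_reducible (n + 1) (extension b M))"

end

theory Submission imports Defs begin

text \<open>Let \<open>n + 1 = 4m\<close> and split the coordinates of the parity-extended words into \<open>m\<close> blocks of
  length 4. The six words of weight 2 in a block form three complementary pairs, labelled 0, 1, 2.
  The words all of whose blocks have weight 2, with labels summing to \<open>a\<close> modulo 3, form a code of
  distance 4, and codes with different \<open>a\<close> are alternatives of each other: after flipping one
  coordinate, exactly one flip in the same block restores weight 2 with any prescribed label.

  The code is irreducible because no two of its coordinates have a constant sum. It is indivisible
  because a mobile part is closed under complementing a block and, once all blocks but two are fixed,
  cannot meet exactly one of the three possible label combinations; hence two parts cannot share such a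
  plane, and the planes connect the code.\<close>

section \<open>Flipping coordinates and parity extension\<close>

definition flip :: "nat \<Rightarrow> bit list \<Rightarrow> bit list" where
  "flip i x = x[i := x ! i + 1]"

lemma length_flip [simp]: "length (flip i x) = length x"
  by (simp add: flip_def)

lemma nth_flip: "j < length x \<Longrightarrow> flip i x ! j = (if i = j then x ! j + 1 else x ! j)"
  by (auto simp: flip_def nth_list_update)

lemma flip_in_words [simp]: "flip i x \<in> words n \<longleftrightarrow> x \<in> words n"
  by (simp add: words_def)

lemma flip_flip [simp]: "flip i (flip i x) = x"
  by (rule nth_equalityI) (auto simp: nth_flip add.assoc)

lemma sum_list_flip:
  assumes "i < length x"
  shows "sum_list (flip i x) = sum_list x + 1"
  using assms
proof (induction x arbitrary: i)
  case (Cons a x)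
  then show ?case by (cases i) (auto simp: flip_def ac_simps)
qed simp

text \<open>The set of differing positions has at most one element, and two different bits differ by
  1, so a single differing position is a flip.\<close>

lemma hdist_le_1_iff:
  assumes "length x = n" "length y = n"
  shows "hdist x y \<le> 1 \<longleftrightarrow> x = y \<or> (\<exists>i<n. x = flip i y)"
proof
  let ?D = "{i. i < length x \<and> x ! i \<noteq> y ! i}"
  assume "hdist x y \<le> 1"
  then have card: "card ?D \<le> Suc 0" by (simp add: hdist_def)
  show "x = y \<or> (\<exists>i<n. x = flip i y)"
  proof (cases "?D = {}")
    case True
    then show ?thesis using assms by (auto intro!: nth_equalityI)
  next
    case False
    then obtain i where i: "i \<in> ?D" by auto
    have uniq: "\<And>j. j \<in> ?D \<Longrightarrow> j = i"
      using card i by (subst (asm) card_le_Suc0_iff_eq) auto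
    have "x = flip i y"
    proof (rule nth_equalityI)
      fix j assume j: "j < length x"
      show "x ! j = flip i y ! j"
      proof (cases "i = j")
        case True
        have "x ! i \<noteq> y ! i" using i by simp
        then have "x ! i = y ! i + 1"
          by (cases "x ! i"; cases "y ! i") auto
        then show ?thesis using True j assms by (simp add: nth_flip)
      next
        case False
        then have "j \<notin> ?D" using uniq by auto
        then show ?thesis using False j assms by (simp add: nth_flip)
      qed
    qed (use assms in simp)
    then show ?thesis using i assms by auto
  qed
next
  assume "x = y \<or> (\<exists>i<n. x = flip i y)"
  then show "hdist x y \<le> 1"
  proof
    assume "x = y"
    then show ?thesis by (simp add: hdist_def)
  next
    assume "\<exists>i<n. x = flip i y"
    then obtain i where "x = flip i y" by auto
    then have "{j. j < length x \<and> x ! j \<noteq> y ! j} \<subseteq> {i}"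
      by (auto simp: nth_flip split: if_splits)
    then have "card {j. j < length x \<and> x ! j \<noteq> y ! j} \<le> card {i}"
      by (rule card_mono[rotated]) simp
    then show ?thesis by (simp add: hdist_def)
  qed
qed

section \<open>Parity extension: words of length n as even or odd words of length n + 1\<close>

definition par :: "bit list \<Rightarrow> bit list" where
  "par x = x @ [sum_list x]"

definition odd_par :: "bit list \<Rightarrow> bit list" where
  "odd_par x = x @ [sum_list x + 1]"

lemma par_in_words [simp]: "par x \<in> words (Suc n) \<longleftrightarrow> x \<in> words n"
  by (simp add: par_def words_def)

lemma par_inj [simp]: "par x = par y \<longleftrightarrow> x = y"
  by (auto simp: par_def)

lemma flip_par_last: "x \<in> words n \<Longrightarrow> flip n (par x) = odd_par x"
  by (auto simp: flip_def par_def odd_par_def words_def nth_append)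

lemma flip_par: "x \<in> words n \<Longrightarrow> i < n \<Longrightarrow> flip i (par x) = odd_par (flip i x)"
  by (simp add: odd_par_def sum_list_flip words_def add.assoc)
     (simp add: flip_def par_def list_update_append nth_append)

lemma odd_par_inj [simp]: "odd_par x = odd_par y \<longleftrightarrow> x = y"
  by (auto simp: odd_par_def)

text \<open>The n + 1 points of the ball around \<open>x\<close> match the n + 1 flips of
  \<open>par x\<close>: coordinate \<open>n\<close> yields the centre, the other coordinates its n
  neighbours.\<close>

lemma hdist_le_1_par:
  assumes "x \<in> words n" "z \<in> words n"
  shows "hdist z x \<le> 1 \<longleftrightarrow> (\<exists>i<Suc n. odd_par z = flip i (par x))"
  using assms hdist_le_1_iff[of z n x]
  by (auto simp: words_def less_Suc_eq flip_par flip_par_last)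

lemma hdist_commute: "length x = length y \<Longrightarrow> hdist x y = hdist y x"
  by (auto simp: hdist_def intro!: arg_cong[where f = card])

lemma flip_par_odd_par:
  assumes "x \<in> words n" "i < Suc n"
  obtains z where "z \<in> words n" "flip i (par x) = odd_par z"
  using assms that[of x] that[of "flip i x"]
  by (auto simp: less_Suc_eq flip_par flip_par_last)

lemma par_butlast:
  assumes "y \<in> words (Suc n)" "sum_list y = 0"
  shows "par (butlast y) = y" "butlast y \<in> words n"
proof -
  from assms obtain x a where y: "y = x @ [a]" "length x = n"
    by (cases y rule: rev_cases) (auto simp: words_def)
  with assms have "a = sum_list x"
    by (cases a; cases "sum_list x") auto
  with y show "par (butlast y) = y" "butlast y \<in> words n" by (auto simp: par_def words_def)
qed

section \<open>Mobility in terms of even words\<close>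

text \<open>Disjointness together with equality of the sets of words one flip away. For
  parity-extended codes this expresses equal neighborhoods, because the odd words of length n + 1
  stand for all words of length n.\<close>

definition exchange :: "nat \<Rightarrow> bit list set \<Rightarrow> bit list set \<Rightarrow> bool" where
  "exchange N A T \<longleftrightarrow> A \<inter> T = {} \<and>
     (\<forall>x\<in>A. \<forall>i<N. \<exists>y\<in>T. \<exists>j<N. flip i x = flip j y) \<and>
     (\<forall>y\<in>T. \<forall>i<N. \<exists>x\<in>A. \<exists>j<N. flip i y = flip j x)"

lemma nbhd_par:
  assumes "M \<subseteq> words n"
  shows "z \<in> nbhd n M \<longleftrightarrow> z \<in> words n \<and> (\<exists>x\<in>M. \<exists>i<Suc n. odd_par z = flip i (par x))"
proof (cases "z \<in> words n")
  case True
  then have "hdist z x \<le> 1 \<longleftrightarrow> (\<exists>i<Suc n. odd_par z = flip i (par x))" if "x \<in> M" for x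
    using hdist_le_1_par that assms by blast
  with True show ?thesis by (simp add: nbhd_def)
qed (simp add: nbhd_def)

lemma nbhd_subset_exchange:
  assumes "A \<subseteq> words n" "T \<subseteq> words n" "nbhd n A \<subseteq> nbhd n T" "x \<in> A" "i < Suc n"
  shows "\<exists>y\<in>T. \<exists>j<Suc n. flip i (par x) = flip j (par y)"
proof -
  obtain z where z: "z \<in> words n" "flip i (par x) = odd_par z"
    using assms flip_par_odd_par[of x n i] by blast
  then have "\<exists>x\<in>A. \<exists>i<Suc n. odd_par z = flip i (par x)"
    using assms(4,5) by metis
  then have "z \<in> nbhd n T"
    using z(1) assms(3) unfolding nbhd_par[OF assms(1)] subset_iff by (metis nbhd_par assms(1))
  then show ?thesis using z(2) unfolding nbhd_par[OF assms(2)] by simp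
qed

lemma mobile_exchange:
  assumes "mobile n A"
  obtains T where "T \<subseteq> words (Suc n)" "exchange (Suc n) (par ` A) T"
proof -
  from assms obtain M' where M': "alternative n A M'" and A: "A \<subseteq> words n"
    by (auto simp: mobile_def one_code_def)
  then have w: "M' \<subseteq> words n" "A \<inter> M' = {}" "nbhd n A = nbhd n M'"
    by (auto simp: alternative_def one_code_def)
  have "exchange (Suc n) (par ` A) (par ` M')"
    using w A nbhd_subset_exchange[of A n M'] nbhd_subset_exchange[of M' n A]
    unfolding exchange_def by auto
  moreover have "par ` M' \<subseteq> words (Suc n)" using w by auto
  ultimately show thesis using that by blast
qed

text \<open>A common point of two balls, extended by \<open>odd_par\<close>, would be one flip away
  from both extended centres.\<close>

lemma one_code_par:
  assumes "M \<subseteq> words n"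
    and "\<And>x y i j. x \<in> M \<Longrightarrow> y \<in> M \<Longrightarrow> i < Suc n \<Longrightarrow> j < Suc n \<Longrightarrow>
           flip i (par x) = flip j (par y) \<Longrightarrow> x = y"
  shows "one_code n M"
  unfolding one_code_def disjoint_family_on_def
proof (intro conjI ballI impI)
  fix x y assume xy: "x \<in> M" "y \<in> M" "x \<noteq> y"
  show "hball n x \<inter> hball n y = {}"
  proof (rule ccontr)
    assume "\<not> ?thesis"
    then obtain z where z: "z \<in> words n" "hdist x z \<le> 1" "hdist y z \<le> 1"
      by (auto simp: hball_def)
    then have "hdist z x \<le> 1" "hdist z y \<le> 1"
      using xy assms(1) hdist_commute[of x z] hdist_commute[of y z]
      by (auto simp: words_def subset_iff)
    then show False
      using z(1) xy assms(2)[of x y] hdist_le_1_par[of x n z] hdist_le_1_par[of y n z] assms(1)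
      by (metis subset_iff)
  qed
qed (use assms in auto)

lemma nbhd_par_subset:
  assumes "A \<subseteq> words n" "T \<subseteq> words n"
    and "\<And>x i. x \<in> A \<Longrightarrow> i < Suc n \<Longrightarrow> \<exists>y\<in>T. \<exists>j<Suc n. flip i (par x) = flip j (par y)"
  shows "nbhd n A \<subseteq> nbhd n T"
proof
  fix z assume "z \<in> nbhd n A"
  then obtain x i where x: "z \<in> words n" "x \<in> A" "i < Suc n" "odd_par z = flip i (par x)"
    unfolding nbhd_par[OF assms(1)] by blast
  with assms(3)[of x i] show "z \<in> nbhd n T"
    unfolding nbhd_par[OF assms(2)] by simp
qed

section \<open>Balanced quadruples\<close>

type_synonym quad = "bit \<times> bit \<times> bit \<times> bit"

fun flip4 :: "nat \<Rightarrow> quad \<Rightarrow> quad" where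
  "flip4 s (a, b, c, d) =
     (if s = 0 then a + 1 else a, if s = 1 then b + 1 else b,
      if s = 2 then c + 1 else c, if s = 3 then d + 1 else d)"

text \<open>For even weight, the second conjunct excludes the weights 0 and 4.\<close>

fun balanced :: "quad \<Rightarrow> bool" where
  "balanced (a, b, c, d) \<longleftrightarrow> a + b + c + d = 0 \<and> (a \<noteq> b \<or> a \<noteq> c)"

text \<open>The three classes are the three complementary pairs of words of weight 2.\<close>

fun pairing :: "quad \<Rightarrow> nat" where
  "pairing (a, b, c, d) = (if a = b then 0 else if a = c then 1 else 2)"

fun compl4 :: "quad \<Rightarrow> quad" where
  "compl4 (a, b, c, d) = (a + 1, b + 1, c + 1, d + 1)"

fun nth4 :: "quad \<Rightarrow> nat \<Rightarrow> bit" where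
  "nth4 (a, b, c, d) s = (if s = 0 then a else if s = 1 then b else if s = 2 then c else d)"

lemma less_4_iff: "s < 4 \<longleftrightarrow> s = 0 \<or> s = 1 \<or> s = 2 \<or> s = (3::nat)"
  by auto

lemma Ex_less_4: "(\<exists>s<4. P s) \<longleftrightarrow> P 0 \<or> P 1 \<or> P 2 \<or> P (3::nat)"
  by (auto simp: less_4_iff)

lemma All_less_4: "(\<forall>s<4. P s) \<longleftrightarrow> P 0 \<and> P 1 \<and> P 2 \<and> P (3::nat)"
  by (auto simp: less_4_iff)

lemma All_less_3: "(\<forall>s<3. P s) \<longleftrightarrow> P 0 \<and> P 1 \<and> P (2::nat)"
  by (auto simp: less_Suc_eq numeral_3_eq_3 numeral_2_eq_2)

lemma All_bit: "(\<forall>a :: bit. P a) \<longleftrightarrow> P 0 \<and> P 1"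
  by (metis bit.exhaust)

text \<open>Expands a claim about quads into 16 closed instances, so that the facts on single blocks
  below can be decided by simplification.\<close>

lemma All_quad:
  "(\<forall>v :: quad. P v) \<longleftrightarrow>
     P (0, 0, 0, 0) \<and> P (0, 0, 0, 1) \<and> P (0, 0, 1, 0) \<and> P (0, 0, 1, 1) \<and>
     P (0, 1, 0, 0) \<and> P (0, 1, 0, 1) \<and> P (0, 1, 1, 0) \<and> P (0, 1, 1, 1) \<and>
     P (1, 0, 0, 0) \<and> P (1, 0, 0, 1) \<and> P (1, 0, 1, 0) \<and> P (1, 0, 1, 1) \<and>
     P (1, 1, 0, 0) \<and> P (1, 1, 0, 1) \<and> P (1, 1, 1, 0) \<and> P (1, 1, 1, 1)"
  unfolding split_paired_All All_bit by simp

lemma pairing_less_3: "pairing v < 3"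
  by (cases v) auto

lemma not_balanced_flip4: "balanced v \<Longrightarrow> s < 4 \<Longrightarrow> \<not> balanced (flip4 s v)"
proof -
  have "\<forall>v. \<forall>s<4. balanced v \<longrightarrow> \<not> balanced (flip4 s v)"
    unfolding All_quad All_less_4 by simp
  then show "balanced v \<Longrightarrow> s < 4 \<Longrightarrow> \<not> balanced (flip4 s v)" by blast
qed

text \<open>After the first flip the weight is 1 or 3. From weight 1, the three words of weight 2
  that can be reached share a one, so no two are complementary and each of the three classes occurs.
  Weight 3 is dual.\<close>

lemma ex_flip4_balanced:
  assumes "balanced v" "s < 4" "c < 3"
  shows "\<exists>t<4. balanced (flip4 t (flip4 s v)) \<and> pairing (flip4 t (flip4 s v)) = c"
proof -
  have "\<forall>v. \<forall>s<4. \<forall>c<3. balanced v \<longrightarrow>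
    (\<exists>t<4. balanced (flip4 t (flip4 s v)) \<and> pairing (flip4 t (flip4 s v)) = c)"
    unfolding All_quad All_less_4 All_less_3 Ex_less_4 by simp
  then show ?thesis using assms by blast
qed

text \<open>A class consists of a word and its complement, whereas two flips at distinct positions
  change exactly two of the four coordinates.\<close>

lemma pairing_flip4_flip4:
  assumes "balanced v" "s < 4" "t < 4" "s \<noteq> t" "balanced (flip4 t (flip4 s v))"
  shows "pairing (flip4 t (flip4 s v)) \<noteq> pairing v"
proof -
  have "\<forall>v. \<forall>s<4. \<forall>t<4. balanced v \<and> s \<noteq> t \<and> balanced (flip4 t (flip4 s v)) \<longrightarrow>
    pairing (flip4 t (flip4 s v)) \<noteq> pairing v"
    unfolding All_quad All_less_4 by simp
  then show ?thesis using assms by blast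
qed

text \<open>If the weight is even, any flip makes it odd. A word of weight 1 or 3 can be flipped to
  weight 0 or 4.\<close>

lemma ex_flip4_not_balanced: "\<exists>s<4. \<not> balanced (flip4 s v)"
proof -
  have "\<forall>v. \<exists>s<4. \<not> balanced (flip4 s v)"
    unfolding All_quad Ex_less_4 by simp
  then show ?thesis by blast
qed

lemma pairing_eq_cases:
  assumes "balanced v" "balanced w" "pairing v = pairing w"
  shows "w = v \<or> w = compl4 v"
proof -
  have "\<forall>v w. balanced v \<and> balanced w \<and> pairing v = pairing w \<longrightarrow> w = v \<or> w = compl4 v"
    unfolding All_quad by simp
  then show ?thesis using assms by blast
qed

lemma nth4_flip4: "i < 4 \<Longrightarrow> j < 4 \<Longrightarrow> nth4 (flip4 i v) j = (if i = j then nth4 v j + 1 else nth4 v j)"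
proof -
  obtain a b c d where "v = (a, b, c, d)" by (cases v) auto
  then have "\<forall>i<4. \<forall>j<4. nth4 (flip4 i v) j = (if i = j then nth4 v j + 1 else nth4 v j)"
    unfolding All_less_4 by simp
  then show "i < 4 \<Longrightarrow> j < 4 \<Longrightarrow> ?thesis" by blast
qed

text \<open>\<open>of_bool (a = 0)\<close> is another form of \<open>a + 1\<close>: inverting a bit
  changes it.\<close>

lemma of_bool_eq_0_neq_bit [simp]: "of_bool (a = 0) \<noteq> (a :: bit)"
  by (cases a) simp_all

text \<open>Take \<open>s'\<close> different from \<open>s\<close> and \<open>t\<close>. Three
  distinct positions are then inverted and the last flip can undo only one of them, so the result is
  not \<open>v\<close>; within the class of \<open>v\<close> only the complement remains.\<close>

lemma flip4_forces_compl4: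
  assumes "balanced v" "s < 4" "t < 4" "s \<noteq> t"
  shows "\<exists>s'<4. \<forall>t'<4. let u = flip4 t' (flip4 s' (flip4 t (flip4 s v))) in
           balanced u \<and> pairing u = pairing v \<longrightarrow> u = compl4 v"
proof -
  have "\<forall>s<4. \<forall>t<4. \<exists>s'<4. s' \<noteq> s \<and> s' \<noteq> (t :: nat)"
    unfolding All_less_4 Ex_less_4 by simp
  then obtain s' where s': "s' < 4" "s' \<noteq> s" "s' \<noteq> t"
    using assms by blast
  have "flip4 t' (flip4 s' (flip4 t (flip4 s v))) \<noteq> v" if t': "t' < 4" for t'
  proof
    let ?u = "flip4 t' (flip4 s' (flip4 t (flip4 s v)))"
    assume "?u = v"
    then have "nth4 ?u s = nth4 v s" "nth4 ?u s' = nth4 v s'" by simp_all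
    then show False
      using assms s' t' by (auto simp: nth4_flip4 split: if_splits)
  qed
  then show ?thesis
    using s'(1) pairing_eq_cases[OF assms(1)] unfolding Let_def by metis
qed

lemma ex_pairing:
  assumes "c < 3"
  shows "\<exists>v. balanced v \<and> pairing v = c"
proof -
  have "\<forall>c<3. \<exists>v\<in>{(0,0,1,1), (0,1,0,1), (0,1,1,0)}. balanced v \<and> pairing v = c"
    unfolding All_less_3 by simp
  then show ?thesis using assms by blast
qed

lemma balanced_compl4 [simp]: "balanced (compl4 v) \<longleftrightarrow> balanced v"
proof -
  have "\<forall>v. balanced (compl4 v) \<longleftrightarrow> balanced v"
    unfolding All_quad by simp
  then show ?thesis by blast
qed

lemma pairing_compl4 [simp]: "pairing (compl4 v) = pairing v"
  by (cases v) auto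

lemma nth4_compl4: "nth4 (compl4 v) s = nth4 v s + 1"
  by (cases v) auto

lemma ex_balanced_nth4:
  assumes "s < 4" "t < 4" "s \<noteq> t"
  shows "\<exists>v. balanced v \<and> nth4 v s + nth4 v t = c"
proof -
  have "\<forall>c. \<forall>s<4. \<forall>t<4. s \<noteq> t \<longrightarrow>
    (\<exists>v\<in>{(0,0,1,1), (0,1,0,1), (0,1,1,0)}. balanced v \<and> nth4 v s + nth4 v t = c)"
    unfolding All_bit All_less_4 by simp
  then show ?thesis using assms by blast
qed

section \<open>Words as sequences of blocks\<close>

definition block :: "bit list \<Rightarrow> nat \<Rightarrow> quad" where
  "block x q = (x ! (4 * q), x ! (4 * q + 1), x ! (4 * q + 2), x ! (4 * q + 3))"

lemma nth4_block: "s < 4 \<Longrightarrow> nth4 (block x q) s = x ! (4 * q + s)"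
  by (auto simp: block_def less_4_iff)

lemma nth_eq_nth4_block: "x ! i = nth4 (block x (i div 4)) (i mod 4)"
  by (simp add: nth4_block)

lemma quad_eqI:
  assumes "\<And>s. s < 4 \<Longrightarrow> nth4 v s = nth4 w s"
  shows "v = w"
  using assms[of 0] assms[of 1] assms[of 2] assms[of 3]
  by (cases v; cases w) simp

lemma block_flip:
  assumes "x \<in> words (4 * m)" "i < 4 * m" "q < m"
  shows "block (flip i x) q = (if i div 4 = q then flip4 (i mod 4) (block x q) else block x q)"
proof (rule quad_eqI)
  fix s :: nat assume s: "s < 4"
  have *: "4 * q + s < length x"
    using assms s by (simp add: words_def)
  have "i = 4 * q + s \<longleftrightarrow> i div 4 = q \<and> i mod 4 = s"
    using s by auto
  then show "nth4 (block (flip i x) q) s =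
      nth4 (if i div 4 = q then flip4 (i mod 4) (block x q) else block x q) s"
    using s * by (simp add: nth4_block nth_flip nth4_flip4)
qed

lemma words_eqI:
  assumes "x \<in> words (4 * m)" "y \<in> words (4 * m)" "\<And>q. q < m \<Longrightarrow> block x q = block y q"
  shows "x = y"
proof (rule nth_equalityI)
  fix i assume "i < length x"
  then have "i div 4 < m" using assms(1) by (auto simp: words_def)
  then show "x ! i = y ! i"
    using assms(3) by (metis nth_eq_nth4_block)
qed (use assms in \<open>auto simp: words_def\<close>)

lemma ex_word_with_blocks: "\<exists>x\<in>words (4 * m). \<forall>q<m. block x q = b q"
proof
  let ?x = "map (\<lambda>i. nth4 (b (i div 4)) (i mod 4)) [0..<4 * m]"
  show "?x \<in> words (4 * m)" by (simp add: words_def)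
  show "\<forall>q<m. block ?x q = b q"
  proof (intro allI impI quad_eqI)
    fix q s :: nat assume "q < m" "s < 4"
    then show "nth4 (block ?x q) s = nth4 (b q) s"
      by (simp add: nth4_block)
  qed
qed

section \<open>The codes with prescribed label sum\<close>

definition balanced_words :: "nat \<Rightarrow> bit list set" where
  "balanced_words m = {x \<in> words (4 * m). \<forall>q<m. balanced (block x q)}"

definition class_code :: "nat \<Rightarrow> nat \<Rightarrow> bit list set" where
  "class_code m a = {x \<in> balanced_words m. (\<Sum>q<m. pairing (block x q)) mod 3 = a}"

lemma balanced_wordsD:
  assumes "x \<in> balanced_words m"
  shows "x \<in> words (4 * m)" "q < m \<Longrightarrow> balanced (block x q)"
  using assms by (auto simp: balanced_words_def)

lemma class_codeD: "x \<in> class_code m a \<Longrightarrow> x \<in> balanced_words m"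
  by (simp add: class_code_def)

lemma sum_list_balanced:
  assumes "x \<in> balanced_words m"
  shows "sum_list x = 0"
proof -
  have x: "length x = m * 4" "\<forall>q<m. balanced (block x q)"
    using assms by (auto simp: balanced_words_def words_def)
  have "sum_list x = (\<Sum>i<m * 4. x ! i)"
    by (simp add: sum_list_sum_nth x atLeast0LessThan)
  also have "\<dots> = (\<Sum>q<m. \<Sum>i\<in>{q * 4..<q * 4 + 4}. x ! i)"
    by (rule sum.nat_group[symmetric])
  also have "\<dots> = (\<Sum>q<m. 0)"
  proof (rule sum.cong)
    fix q assume "q \<in> {..<m}"
    then have "balanced (block x q)" using x by simp
    have "{q * 4..<q * 4 + 4} = {4 * q, 4 * q + 1, 4 * q + 2, 4 * q + 3}" by auto
    then have "(\<Sum>i\<in>{q * 4..<q * 4 + 4}. x ! i) =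
        x ! (4 * q) + x ! (4 * q + 1) + x ! (4 * q + 2) + x ! (4 * q + 3)"
      by (simp add: ac_simps del: add_bit_eq_xor)
    also have "\<dots> = 0"
      using \<open>balanced (block x q)\<close> by (simp only: block_def balanced.simps)
    finally show "(\<Sum>i\<in>{q * 4..<q * 4 + 4}. x ! i) = 0" .
  qed simp
  finally show ?thesis by simp
qed

text \<open>All blocks but \<open>r\<close> are free; the label of block \<open>r\<close> corrects
  the sum.\<close>

lemma ex_class_code:
  assumes "r < m" "a < 3" "\<And>q. q < m \<Longrightarrow> q \<noteq> r \<Longrightarrow> balanced (b q)"
  shows "\<exists>x\<in>class_code m a. \<forall>q<m. q \<noteq> r \<longrightarrow> block x q = b q"
proof -
  let ?S = "\<Sum>q\<in>{..<m} - {r}. pairing (b q)"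
  \<comment> \<open>Modulo 3, \<open>2 * ?S\<close> is the negative of \<open>?S\<close>; this
    avoids subtraction of natural numbers.\<close>
  obtain v where v: "balanced v" "pairing v = (a + 2 * ?S) mod 3"
    using ex_pairing[OF mod_less_divisor[of 3 "a + 2 * ?S"]]
    by (auto simp del: balanced.simps pairing.simps split_paired_Ex)
  obtain x where x: "x \<in> words (4 * m)" "\<forall>q<m. block x q = (b(r := v)) q"
    using ex_word_with_blocks by blast
  have "(\<Sum>q<m. pairing (block x q)) = pairing (block x r) + (\<Sum>q\<in>{..<m} - {r}. pairing (block x q))"
    using assms(1) by (simp add: sum.remove)
  also have "\<dots> = (a + 2 * ?S) mod 3 + ?S"
    using x v assms(1) by (auto intro!: arg_cong2[where f = "(+)"] sum.cong)
  also have "\<dots> mod 3 = a"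
    using \<open>a < 3\<close> by presburger
  finally have "x \<in> class_code m a"
    using x v assms by (auto simp: class_code_def balanced_words_def)
  then show ?thesis using x(2) by (auto intro!: bexI[of _ x])
qed

text \<open>The label sum is fixed modulo 3 and labels are below 3, so each label is a function of
  the others.\<close>

lemma pairing_determined:
  assumes "x \<in> class_code m a" "y \<in> class_code m a" "r < m"
    and "\<And>q. q < m \<Longrightarrow> q \<noteq> r \<Longrightarrow> pairing (block x q) = pairing (block y q)"
  shows "pairing (block x r) = pairing (block y r)"
proof -
  let ?S = "\<lambda>x. \<Sum>q\<in>{..<m} - {r}. pairing (block x q)"
  have "(\<Sum>q<m. pairing (block z q)) = pairing (block z r) + ?S z" for z
    using assms(3) by (simp add: sum.remove)
  moreover have "?S x = ?S y"
    using assms(4) by (intro sum.cong) auto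
  ultimately have "(pairing (block x r) + ?S y) mod 3 = (pairing (block y r) + ?S y) mod 3"
    using assms(1,2) by (simp add: class_code_def)
  then show ?thesis
    using pairing_less_3[of "block x r"] pairing_less_3[of "block y r"] by presburger
qed

text \<open>Flipping \<open>x\<close> at \<open>i\<close> unbalances the block of \<open>i\<close>.
  The second flip must repair that same block, and at another position because \<open>y\<close>
  differs from \<open>x\<close>.\<close>

lemma balanced_words_adjacent:
  assumes "x \<in> balanced_words m" "y \<in> balanced_words m" "x \<noteq> y"
    and "i < 4 * m" "j < 4 * m" "flip i x = flip j y"
  shows "\<exists>t<4. t \<noteq> i mod 4 \<and>
           block y (i div 4) = flip4 t (flip4 (i mod 4) (block x (i div 4))) \<and>
           (\<forall>r<m. r \<noteq> i div 4 \<longrightarrow> block y r = block x r)"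
proof -
  let ?q = "i div 4"
  have q: "?q < m" using assms(4) by simp
  have x: "x \<in> words (4 * m)" and y: "y \<in> words (4 * m)"
    using assms by (auto dest: balanced_wordsD)
  have y_eq: "y = flip j (flip i x)" using assms(6) by simp
  have blk: "block y r = (if j div 4 = r then flip4 (j mod 4) (block (flip i x) r) else block (flip i x) r)"
    if "r < m" for r
    unfolding y_eq using that x assms(5) by (simp add: block_flip)
  have "j div 4 = ?q"
  proof (rule ccontr)
    assume "j div 4 \<noteq> ?q"
    then have "block y ?q = flip4 (i mod 4) (block x ?q)"
      using blk[OF q] block_flip[OF x assms(4) q] by simp
    then show False
      using not_balanced_flip4[of "block x ?q" "i mod 4"] q
        balanced_wordsD(2)[OF assms(1) q] balanced_wordsD(2)[OF assms(2) q] by simp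
  qed
  moreover have "j \<noteq> i" using y_eq assms(3) by auto
  ultimately have "j mod 4 \<noteq> i mod 4"
    by (metis div_mult_mod_eq)
  then show ?thesis
    using blk q \<open>j div 4 = ?q\<close> x assms(4)
    by (intro exI[of _ "j mod 4"]) (auto simp: block_flip)
qed

text \<open>Two distinct code words at distance 2 would differ in one block only and have different
  labels there, against the common label sum.\<close>

lemma class_code_flip_unique:
  assumes "x \<in> class_code m a" "y \<in> class_code m a" "i < 4 * m" "j < 4 * m" "flip i x = flip j y"
  shows "x = y"
proof (rule ccontr)
  assume ne: "x \<noteq> y"
  let ?q = "i div 4"
  have q: "?q < m" using assms(3) by simp
  have bal: "x \<in> balanced_words m" "y \<in> balanced_words m"
    using assms class_codeD by auto
  obtain t where t: "t < 4" "t \<noteq> i mod 4"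
    "block y ?q = flip4 t (flip4 (i mod 4) (block x ?q))"
    "\<forall>r<m. r \<noteq> ?q \<longrightarrow> block y r = block x r"
    using balanced_words_adjacent[OF bal ne assms(3-5)] by blast
  have "pairing (block y ?q) \<noteq> pairing (block x ?q)"
    using pairing_flip4_flip4[of "block x ?q" "i mod 4" t] t bal q balanced_wordsD(2)
    by (metis mod_less_divisor zero_less_numeral)
  moreover have "pairing (block y ?q) = pairing (block x ?q)"
    using pairing_determined[OF assms(2,1) q] t(4) by simp
  ultimately show False by simp
qed

text \<open>A second flip in the block of \<open>i\<close> can produce any label, in particular the
  one that turns the label sum into \<open>b\<close>.\<close>

lemma class_code_covers:
  assumes "x \<in> class_code m a" "i < 4 * m" "b < 3"
  shows "\<exists>y\<in>class_code m b. \<exists>j<4 * m. flip i x = flip j y"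
proof -
  let ?q = "i div 4"
  let ?S = "\<Sum>r\<in>{..<m} - {?q}. pairing (block x r)"
  have q: "?q < m" using assms(2) by simp
  have x: "x \<in> words (4 * m)" and bal: "\<And>r. r < m \<Longrightarrow> balanced (block x r)"
    using assms(1) by (auto dest!: class_codeD simp: balanced_words_def)
  obtain t where t: "t < 4" "balanced (flip4 t (flip4 (i mod 4) (block x ?q)))"
    "pairing (flip4 t (flip4 (i mod 4) (block x ?q))) = (b + 2 * ?S) mod 3"
    using ex_flip4_balanced[OF bal[OF q], of "i mod 4" "(b + 2 * ?S) mod 3"] by auto
  define j where "j = 4 * ?q + t"
  have j: "j < 4 * m" "j div 4 = ?q" "j mod 4 = t"
    using t(1) q by (auto simp: j_def)
  define y where "y = flip j (flip i x)"
  have blk: "block y r = (if r = ?q then flip4 t (flip4 (i mod 4) (block x r)) else block x r)"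
    if "r < m" for r
    unfolding y_def using that x assms(2) j by (auto simp: block_flip)
  have "(\<Sum>r<m. pairing (block y r)) = pairing (block y ?q) + (\<Sum>r\<in>{..<m} - {?q}. pairing (block y r))"
    using q by (simp add: sum.remove)
  also have "\<dots> = (b + 2 * ?S) mod 3 + ?S"
    using blk t(3) q by (auto intro!: arg_cong2[where f = "(+)"] sum.cong)
  also have "\<dots> mod 3 = b"
    using \<open>b < 3\<close> by presburger
  finally have "y \<in> class_code m b"
    using x bal blk t(2) by (auto simp: class_code_def balanced_words_def y_def)
  moreover have "flip i x = flip j y" by (simp add: y_def)
  ultimately show ?thesis using j(1) by blast
qed


text \<open>This is the obstruction to reducibility. In one block, balanced quads realize both
  values of the sum of two coordinates; across blocks, complementing one of the two blocks changes
  the sum.\<close>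

lemma class_code_separates:
  assumes "2 \<le> m" "i < 4 * m" "j < 4 * m" "i \<noteq> j"
  shows "\<exists>x\<in>class_code m 0. \<exists>y\<in>class_code m 0. x ! i + x ! j \<noteq> y ! i + y ! j"
proof (cases "i div 4 = j div 4")
  case True
  define q where "q = i div 4"
  have q: "q < m" "i div 4 = q" "j div 4 = q" using assms True by (auto simp: q_def)
  have "i mod 4 \<noteq> j mod 4"
    using True assms(4) by (metis div_mult_mod_eq)
  then have *: "\<exists>v. balanced v \<and> nth4 v (i mod 4) + nth4 v (j mod 4) = c" for c
    by (intro ex_balanced_nth4) auto
  obtain v where v: "balanced v" "nth4 v (i mod 4) + nth4 v (j mod 4) = 0"
    using *[of 0] by (elim exE conjE)
  obtain w where w: "balanced w" "nth4 w (i mod 4) + nth4 w (j mod 4) = 1"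
    using *[of 1] by (elim exE conjE)
  \<comment> \<open>A second block, available since \<open>2 \<le> m\<close>, absorbs the correction
    of the label sum.\<close>
  obtain r where r: "r < m" "q \<noteq> r"
    using assms(1) that[of 0] that[of 1] by (cases "q = 0") simp_all
  obtain x where x: "x \<in> class_code m 0" "\<forall>q<m. q \<noteq> r \<longrightarrow> block x q = v"
    using ex_class_code[of r m 0 "\<lambda>_. v"] r v by auto
  obtain y where y: "y \<in> class_code m 0" "\<forall>q<m. q \<noteq> r \<longrightarrow> block y q = w"
    using ex_class_code[of r m 0 "\<lambda>_. w"] r w by auto
  have "x ! i + x ! j = 0" "y ! i + y ! j = 1"
    unfolding nth_eq_nth4_block[of _ i] nth_eq_nth4_block[of _ j] q
    using x(2) y(2) v(2) w(2) r q(1) by (simp_all del: add_bit_eq_xor)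
  then show ?thesis using x(1) y(1) by (metis zero_neq_one)
next
  case False
  define q where "q = i div 4"
  have q: "q < m" using assms(2) by (simp add: q_def)
  obtain v where v: "balanced v" using that[of "(0, 0, 1, 1)"] by simp
  obtain x where x: "x \<in> class_code m 0"
    using ex_class_code[of q m 0 "\<lambda>_. v"] q v by auto
  \<comment> \<open>Complementing block \<open>q\<close> keeps its label, hence membership in the
    code, and inverts coordinate \<open>i\<close> but not \<open>j\<close>.\<close>
  obtain y where y: "y \<in> words (4 * m)"
    "\<forall>r<m. block y r = ((block x)(q := compl4 (block x q))) r"
    using ex_word_with_blocks by blast
  have "y \<in> class_code m 0"
  proof -
    have "pairing (block y r) = pairing (block x r)" if "r < m" for r
      using y(2) that by simp
    then have "(\<Sum>r<m. pairing (block y r)) = (\<Sum>r<m. pairing (block x r))"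
      by (intro sum.cong) auto
    then show ?thesis
      using x y by (auto simp: class_code_def balanced_words_def)
  qed
  moreover have "y ! i = x ! i + 1"
    unfolding nth_eq_nth4_block[of _ i] using y(2) q by (simp add: q_def nth4_compl4)
  moreover have "y ! j = x ! j"
  proof -
    have "j div 4 < m" "j div 4 \<noteq> q" using assms(3) False by (simp_all add: q_def)
    then have "block y (j div 4) = block x (j div 4)" using y(2) by simp
    then show ?thesis unfolding nth_eq_nth4_block[of _ j] by simp
  qed
  moreover have "a + 1 + b \<noteq> a + b" for a b :: bit
    by (cases a; cases b) simp_all
  ultimately show ?thesis
    using x by metis
qed

section \<open>Mobile parts of the code\<close>

text \<open>\<open>A\<close> stands for the parity extension of a mobile part of the code and
  \<open>T\<close> for that of its alternative. Nothing is assumed about the block structure of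
  \<open>T\<close>; it is derived from \<open>exchange\<close>.\<close>

locale exchangeable =
  fixes m :: nat and A T :: "bit list set"
  assumes two_blocks: "2 \<le> m"
    and A_subset: "A \<subseteq> class_code m 0"
    and T_subset: "T \<subseteq> words (4 * m)"
    and exchange: "exchange (4 * m) A T"
begin

lemma A_balanced: "x \<in> A \<Longrightarrow> x \<in> balanced_words m"
  using A_subset class_codeD by blast

text \<open>A word adjacent to a balanced one has at most one unbalanced block, whereas an unbalanced
  word can be given a second unbalanced block by one flip.\<close>

lemma T_balanced:
  assumes "y \<in> T"
  shows "y \<in> balanced_words m"
proof (rule ccontr)
  assume "y \<notin> balanced_words m"
  then obtain r where r: "r < m" "\<not> balanced (block y r)"
    using assms T_subset by (auto simp: balanced_words_def)
  have y: "y \<in> words (4 * m)" using assms T_subset by blast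
  obtain q where q: "q < m" "q \<noteq> r"
    using two_blocks that[of 0] that[of 1] by (cases "r = 0") simp_all
  obtain s where s: "s < 4" "\<not> balanced (flip4 s (block y q))"
    using ex_flip4_not_balanced by blast
  have i: "4 * q + s < 4 * m" "(4 * q + s) div 4 = q" "(4 * q + s) mod 4 = s"
    using s(1) q(1) by auto
  then obtain x j where x: "x \<in> A" "j < 4 * m" "flip (4 * q + s) y = flip j x"
    using exchange assms unfolding exchange_def by blast
  have "j div 4 = p" if "p < m" "\<not> balanced (block (flip j x) p)" for p
    using block_flip[of x m j p] that x A_balanced balanced_wordsD by metis
  moreover have "\<not> balanced (block (flip (4 * q + s) y) q)" "\<not> balanced (block (flip (4 * q + s) y) r)"
    using block_flip[OF y i(1)] q r s i by simp_all
  ultimately show False using x(3) q r(1) by metis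
qed

text \<open>One can pass from \<open>A\<close> to \<open>T\<close> within any chosen block, starting
  with any chosen flip; \<open>t \<noteq> s\<close> because \<open>A\<close> and \<open>T\<close>
  are disjoint.\<close>

lemma exchange_in_block:
  assumes "x \<in> A" "q < m" "s < 4"
  shows "\<exists>y\<in>T. \<exists>t<4. t \<noteq> s \<and> block y q = flip4 t (flip4 s (block x q)) \<and>
           (\<forall>r<m. r \<noteq> q \<longrightarrow> block y r = block x r)"
proof -
  have i: "4 * q + s < 4 * m" "(4 * q + s) div 4 = q" "(4 * q + s) mod 4 = s"
    using assms by auto
  then obtain y j where y: "y \<in> T" "j < 4 * m" "flip (4 * q + s) x = flip j y"
    using exchange assms unfolding exchange_def by blast
  then have "x \<noteq> y" using exchange assms unfolding exchange_def by blast
  then show ?thesis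
    using balanced_words_adjacent[OF A_balanced[OF assms(1)] T_balanced[OF y(1)] _ i(1) y(2,3)]
      y(1) i by auto
qed

lemma exchange_back_in_block:
  assumes "y \<in> T" "q < m" "s < 4"
  shows "\<exists>x\<in>A. \<exists>t<4. t \<noteq> s \<and> block x q = flip4 t (flip4 s (block y q)) \<and>
           (\<forall>r<m. r \<noteq> q \<longrightarrow> block x r = block y r)"
proof -
  have i: "4 * q + s < 4 * m" "(4 * q + s) div 4 = q" "(4 * q + s) mod 4 = s"
    using assms by auto
  then obtain x j where x: "x \<in> A" "j < 4 * m" "flip (4 * q + s) y = flip j x"
    using exchange assms unfolding exchange_def by blast
  then have "y \<noteq> x" using exchange assms unfolding exchange_def by blast
  then show ?thesis
    using balanced_words_adjacent[OF T_balanced[OF assms(1)] A_balanced[OF x(1)] _ i(1) x(2,3)]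
      x(1) i by auto
qed

text \<open>Pass to \<open>T\<close> and back to \<open>A\<close> inside block \<open>q\<close>. The
  label of that block is restored because the other blocks are unchanged, and the first flip on the
  way back is chosen so that the block itself cannot be restored.\<close>

lemma complement_block:
  assumes "x \<in> A" "q < m"
  shows "\<exists>x'\<in>A. block x' q = compl4 (block x q) \<and> (\<forall>r<m. r \<noteq> q \<longrightarrow> block x' r = block x r)"
proof -
  have bal: "balanced (block z q)" if "z \<in> A" for z
    using that A_balanced balanced_wordsD(2) assms(2) by blast
  obtain y t where y: "y \<in> T" "t < 4" "t \<noteq> 0" "block y q = flip4 t (flip4 0 (block x q))"
    "\<forall>r<m. r \<noteq> q \<longrightarrow> block y r = block x r"
    using exchange_in_block[OF assms, of 0] by auto
  obtain s where s: "s < 4" "\<And>t' u. t' < 4 \<Longrightarrow> u = flip4 t' (flip4 s (block y q)) \<Longrightarrow>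
      balanced u \<Longrightarrow> pairing u = pairing (block x q) \<Longrightarrow> u = compl4 (block x q)"
    using flip4_forces_compl4[OF bal[OF assms(1)], of 0 t] y unfolding Let_def by auto
  obtain x' t' where x': "x' \<in> A" "t' < 4" "block x' q = flip4 t' (flip4 s (block y q))"
    "\<forall>r<m. r \<noteq> q \<longrightarrow> block x' r = block y r"
    using exchange_back_in_block[OF y(1) assms(2) s(1)] by blast
  have rest: "\<forall>r<m. r \<noteq> q \<longrightarrow> block x' r = block x r" using y(5) x'(4) by simp
  then have "pairing (block x' q) = pairing (block x q)"
    using pairing_determined[of x' m 0 x q] x'(1) assms A_subset by auto
  then have "block x' q = compl4 (block x q)"
    using s(2)[OF x'(2,3)] bal[OF x'(1)] by blast
  then show ?thesis using x'(1) rest by blast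
qed

lemma replace_block:
  assumes "x \<in> A" "q < m" "balanced v" "pairing v = pairing (block x q)"
  shows "\<exists>x'\<in>A. block x' q = v \<and> (\<forall>r<m. r \<noteq> q \<longrightarrow> block x' r = block x r)"
proof -
  have "balanced (block x q)" using assms A_balanced balanced_wordsD(2) by blast
  then have "v = block x q \<or> v = compl4 (block x q)"
    using pairing_eq_cases assms by simp
  then show ?thesis using complement_block[OF assms(1,2)] assms(1) by blast
qed

text \<open>Pass to \<open>T\<close> inside block \<open>q\<close>, which changes its label, and
  return to \<open>A\<close> inside block \<open>r\<close>, which leaves block \<open>q\<close>
  alone.\<close>

lemma change_pairing:
  assumes "x \<in> A" "q < m" "r < m" "q \<noteq> r"
  shows "\<exists>x'\<in>A. pairing (block x' q) \<noteq> pairing (block x q) \<and>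
           (\<forall>p<m. p \<noteq> q \<longrightarrow> p \<noteq> r \<longrightarrow> block x' p = block x p)"
proof -
  obtain y t where y: "y \<in> T" "t < 4" "t \<noteq> 0" "block y q = flip4 t (flip4 0 (block x q))"
    "\<forall>r<m. r \<noteq> q \<longrightarrow> block y r = block x r"
    using exchange_in_block[OF assms(1,2), of 0] by auto
  have "balanced (block x q)" "balanced (block y q)"
    using balanced_wordsD(2) A_balanced[OF assms(1)] T_balanced[OF y(1)] assms(2) by blast+
  then have ne: "pairing (block y q) \<noteq> pairing (block x q)"
    using pairing_flip4_flip4[of "block x q" 0 t] y by simp
  obtain x' where "x' \<in> A" "\<forall>p<m. p \<noteq> r \<longrightarrow> block x' p = block y p"
    using exchange_back_in_block[OF y(1) assms(3), of 0] by auto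
  then show ?thesis using ne y(5) assms by (intro bexI[of _ x']) auto
qed

text \<open>The label in \<open>q\<close> determines the one in \<open>r\<close>, so both labels
  agree with those of \<open>x\<close>, and the two blocks can be replaced one after the
  other.\<close>

lemma same_pairings:
  assumes "x \<in> A" "z \<in> class_code m 0" "q < m" "r < m" "q \<noteq> r"
    and "\<And>p. p < m \<Longrightarrow> p \<noteq> q \<Longrightarrow> p \<noteq> r \<Longrightarrow> block z p = block x p"
    and "pairing (block z q) = pairing (block x q)"
  shows "z \<in> A"
proof -
  have z: "balanced (block z p)" if "p < m" for p
    using that assms(2) class_codeD balanced_wordsD(2) by blast
  obtain x1 where x1: "x1 \<in> A" "block x1 q = block z q" "\<forall>p<m. p \<noteq> q \<longrightarrow> block x1 p = block x p"
    using replace_block[OF assms(1,3) z[OF assms(3)] assms(7)] by blast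
  have "pairing (block z r) = pairing (block x1 r)"
    using pairing_determined[OF assms(2) _ assms(4), of x1] x1 assms(6) A_subset by fastforce
  then obtain x2 where x2: "x2 \<in> A" "block x2 r = block z r" "\<forall>p<m. p \<noteq> r \<longrightarrow> block x2 p = block x1 p"
    using replace_block[OF x1(1) assms(4) z[OF assms(4)]] by blast
  have "x2 = z"
  proof (rule words_eqI)
    show "x2 \<in> words (4 * m)" "z \<in> words (4 * m)"
      using x2(1) assms(2) A_balanced class_codeD balanced_wordsD(1) by blast+
    show "block x2 p = block z p" if "p < m" for p
      using that x1 x2 assms(6) by metis
  qed
  then show ?thesis using x2(1) by simp
qed

end

text \<open>Fixing all blocks but two leaves three cells, one for each class in block \<open>q\<close>. A part meeting
  this plane contains each cell that it meets and meets at least two cells, so two parts would share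
  a cell.\<close>

lemma plane_in_one_part:
  assumes "exchangeable m A T" "exchangeable m B U" "A \<inter> B = {}" "A \<union> B = class_code m 0"
    and "x \<in> A" "z \<in> class_code m 0" "q < m" "r < m" "q \<noteq> r"
    and agree: "\<And>p. p < m \<Longrightarrow> p \<noteq> q \<Longrightarrow> p \<noteq> r \<Longrightarrow> block z p = block x p"
  shows "z \<in> A"
proof (rule ccontr)
  interpret A: exchangeable m A T by fact
  interpret B: exchangeable m B U by fact
  assume "z \<notin> A"
  then have "z \<in> B" using assms(4,6) by blast
  obtain x' where x': "x' \<in> A" "pairing (block x' q) \<noteq> pairing (block x q)"
    "\<forall>p<m. p \<noteq> q \<longrightarrow> p \<noteq> r \<longrightarrow> block x' p = block x p"
    using A.change_pairing[OF assms(5,7-9)] by blast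
  obtain z' where z': "z' \<in> B" "pairing (block z' q) \<noteq> pairing (block z q)"
    "\<forall>p<m. p \<noteq> q \<longrightarrow> p \<noteq> r \<longrightarrow> block z' p = block z p"
    using B.change_pairing[OF \<open>z \<in> B\<close> assms(7-9)] by blast
  have "\<exists>u\<in>{x, x'}. \<exists>v\<in>{z, z'}. pairing (block v q) = pairing (block u q)"
    using x'(2) z'(2) pairing_less_3[of "block x q"] pairing_less_3[of "block x' q"]
      pairing_less_3[of "block z q"] pairing_less_3[of "block z' q"] by auto
  then obtain u v where uv: "u \<in> {x, x'}" "v \<in> {z, z'}" "pairing (block v q) = pairing (block u q)"
    by blast
  have "u \<in> A" "v \<in> B" using uv assms(5) x' z' \<open>z \<in> B\<close> by auto
  moreover have "block v p = block u p" if "p < m" "p \<noteq> q" "p \<noteq> r" for p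
    using uv(1,2) x'(3) z'(3) agree that by auto
  ultimately have "v \<in> A"
    using A.same_pairings[of u v q r] uv(3) B.A_subset assms(7-9) by blast
  then show False using \<open>v \<in> B\<close> assms(3) by blast
qed

text \<open>Any code word \<open>z\<close> is reached from a word of \<open>A\<close> by correcting
  the blocks from left to right. Each correction stays in the plane of the current block and the
  last block, hence in \<open>A\<close>.\<close>

lemma no_two_parts:
  assumes "exchangeable m A T" "exchangeable m B U" "A \<inter> B = {}" "A \<union> B = class_code m 0"
    and "A \<noteq> {}"
  shows "B = {}"
proof -
  interpret A: exchangeable m A T by fact
  \<comment> \<open>The last block is reserved for adjusting the label sum, so the induction
    corrects only the blocks before it.\<close>
  define r where "r = m - 1"
  have r: "r < m" "0 < r" using A.two_blocks by (auto simp: r_def)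
  have "z \<in> A" if z: "z \<in> class_code m 0" for z
  proof -
    have "\<exists>x\<in>A. \<forall>q<p. block x q = block z q" if "p \<le> r" for p
      using that
    proof (induction p)
      case 0
      then show ?case using assms(5) by blast
    next
      case (Suc p)
      then obtain x where x: "x \<in> A" "\<forall>q<p. block x q = block z q" by auto
      have bal: "balanced (((block x)(p := block z p)) q)" if "q < m" for q
        using that A.A_balanced[OF x(1)] class_codeD[OF z] balanced_wordsD(2) by simp
      then obtain w where w: "w \<in> class_code m 0"
        "\<forall>q<m. q \<noteq> r \<longrightarrow> block w q = ((block x)(p := block z p)) q"
        using ex_class_code[OF r(1), of 0 "(block x)(p := block z p)"] by auto
      have "w \<in> A"
        using plane_in_one_part[OF assms(1-4) x(1) w(1), of p r] Suc.prems r w(2) by simp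
      moreover have "\<forall>q<Suc p. block w q = block z q"
        using w(2) x(2) Suc.prems r by (auto simp: less_Suc_eq)
      ultimately show ?case by blast
    qed
    then obtain x where x: "x \<in> A" "\<forall>q<r. block x q = block z q" by blast
    \<comment> \<open>Now \<open>x\<close> and \<open>z\<close> can differ in block \<open>r\<close>
      only, so they share the plane of blocks 0 and \<open>r\<close>.\<close>
    have "block z p = block x p" if "p < m" "p \<noteq> 0" "p \<noteq> r" for p
      using x(2) that by (auto simp: r_def)
    then show "z \<in> A"
      using plane_in_one_part[OF assms(1-4) x(1) z, of 0 r] r by auto
  qed
  then show ?thesis using assms(3,4) by blast
qed

section \<open>Reducible sets have two dependent coordinates\<close>

lemma ext_mobile_subset_words: "ext_mobile m M \<Longrightarrow> M \<subseteq> words m"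
  by (auto simp: ext_mobile_def mobile_def one_code_def extension_def words_def)

text \<open>The two coordinates appended by \<open>doubling\<close> are always equal. A permutation
  moves them and inversions add a constant to their sum.\<close>

lemma ext_reducible_dependent_coords:
  assumes "ext_reducible k S"
  shows "\<exists>i<k. \<exists>j<k. i \<noteq> j \<and> (\<exists>c. \<forall>w\<in>S. w ! i + w ! j = c)"
proof -
  obtain m M M' p z where k: "k = m + 2" and M: "ext_mobile m M" "ext_alternative m M M'"
    and p: "p permutes {..<k}" and S: "S = permute_invert p z ` doubling M M'"
    using assms unfolding ext_reducible_def by blast
  have words: "M \<subseteq> words m" "M' \<subseteq> words m"
    using M ext_mobile_subset_words by (auto simp: ext_alternative_def one_code_def)
  \<comment> \<open>\<open>permute_invert\<close> reads coordinate \<open>p i\<close> at position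
    \<open>i\<close>, so these are the new positions of the appended coordinates.\<close>
  define i j where "i = inv p m" and "j = inv p (m + 1)"
  have pi: "p i = m" "p j = m + 1"
    using permutes_inverses(1)[OF p] by (simp_all add: i_def j_def)
  have ij: "i < k" "j < k"
    using permutes_in_image[OF p] pi k by (metis lessThan_iff less_add_same_cancel1 zero_less_numeral,
      metis lessThan_iff add_less_cancel_left one_less_numeral_iff semiring_norm(76))
  have "w ! i + w ! j = z ! i + z ! j" if "w \<in> S" for w
  proof -
    obtain x where x: "x \<in> doubling M M'" "w = permute_invert p z x"
      using \<open>w \<in> S\<close> S by blast
    then have "length x = k" "x ! m = x ! (m + 1)"
      using words k by (auto simp: doubling_def words_def nth_append subset_iff)
    then have "w ! i = x ! m + z ! i" "w ! j = x ! m + z ! j"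
      using x(2) ij pi by (simp_all add: permute_invert_def)
    then show ?thesis by (cases "x ! m"; cases "z ! i"; cases "z ! j") simp_all
  qed
  moreover have "i \<noteq> j" using pi by auto
  ultimately show ?thesis using ij by blast
qed

section \<open>Puncturing the code\<close>

definition punctured_code :: "nat \<Rightarrow> nat \<Rightarrow> nat \<Rightarrow> bit list set" where
  "punctured_code n m a = {x \<in> words n. par x \<in> class_code m a}"

context
  fixes n m :: nat
  assumes n: "Suc n = 4 * m"
begin

text \<open>Code words have even weight, so their last coordinate is the parity check of the
  others.\<close>

lemma par_punctured_code: "par ` punctured_code n m a = class_code m a"
proof
  show "class_code m a \<subseteq> par ` punctured_code n m a"
  proof
    fix y assume y: "y \<in> class_code m a"
    then have "y \<in> words (Suc n)" "sum_list y = 0"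
      using n balanced_wordsD(1)[OF class_codeD] sum_list_balanced[OF class_codeD] by auto
    then have "par (butlast y) = y" "butlast y \<in> words n"
      using par_butlast by auto
    then show "y \<in> par ` punctured_code n m a"
      using y by (intro image_eqI[of _ _ "butlast y"]) (auto simp: punctured_code_def)
  qed
qed (auto simp: punctured_code_def)

lemma one_code_punctured_code: "one_code n (punctured_code n m a)"
proof (rule one_code_par)
  fix x y i j
  assume "x \<in> punctured_code n m a" "y \<in> punctured_code n m a" "i < Suc n" "j < Suc n"
    "flip i (par x) = flip j (par y)"
  then have "par x = par y"
    using class_code_flip_unique[of "par x" m a "par y" i j] n by (simp add: punctured_code_def)
  then show "x = y" by simp
qed (auto simp: punctured_code_def)

lemma nbhd_punctured_code_subset:
  assumes "b < 3"
  shows "nbhd n (punctured_code n m a) \<subseteq> nbhd n (punctured_code n m b)"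
proof (rule nbhd_par_subset)
  fix x i assume "x \<in> punctured_code n m a" "i < Suc n"
  then obtain y j where "y \<in> class_code m b" "j < Suc n" "flip i (par x) = flip j y"
    using class_code_covers[of "par x" m a i b] n assms by (auto simp: punctured_code_def)
  then show "\<exists>y\<in>punctured_code n m b. \<exists>j<Suc n. flip i (par x) = flip j (par y)"
    using par_punctured_code[of b] by (metis imageE)
qed (auto simp: punctured_code_def)

lemma mobile_punctured_code: "mobile n (punctured_code n m 0)"
proof -
  have "alternative n (punctured_code n m 0) (punctured_code n m 1)"
    unfolding alternative_def
    using one_code_punctured_code nbhd_punctured_code_subset[of 1 0] nbhd_punctured_code_subset[of 0 1]
    by (auto simp: punctured_code_def class_code_def)
  then show ?thesis unfolding mobile_def using one_code_punctured_code by blast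
qed

lemma mobile_exchangeable:
  assumes "2 \<le> m" "mobile n A" "A \<subseteq> punctured_code n m 0"
  obtains T where "exchangeable m (par ` A) T"
proof -
  obtain T where "T \<subseteq> words (Suc n)" "exchange (Suc n) (par ` A) T"
    using mobile_exchange[OF assms(2)] by blast
  then have "exchangeable m (par ` A) T"
    using assms n by (auto simp: exchangeable_def punctured_code_def)
  then show thesis using that by blast
qed

lemma not_divisible_punctured_code:
  assumes "2 \<le> m"
  shows "\<not> divisible n (punctured_code n m 0)"
proof
  assume "divisible n (punctured_code n m 0)"
  then obtain A B where AB: "mobile n A" "A \<noteq> {}" "mobile n B" "B \<noteq> {}" "A \<inter> B = {}"
    "punctured_code n m 0 = A \<union> B"
    unfolding divisible_def by (elim conjE exE)
  have sub: "A \<subseteq> punctured_code n m 0" "B \<subseteq> punctured_code n m 0" using AB(6) by auto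
  have un: "par ` A \<union> par ` B = class_code m 0"
    by (metis AB(6) image_Un par_punctured_code)
  have disj: "par ` A \<inter> par ` B = {}" using AB(5) by auto
  obtain T where T: "exchangeable m (par ` A) T"
    by (rule mobile_exchangeable[OF assms AB(1) sub(1)])
  obtain U where U: "exchangeable m (par ` B) U"
    by (rule mobile_exchangeable[OF assms AB(3) sub(2)])
  have "par ` B = {}"
    by (rule no_two_parts[OF T U disj un]) (simp add: AB(2))
  then show False using AB(4) by simp
qed

text \<open>Treats both extensions at once: they differ from \<open>par x\<close> at most in the
  last coordinate, by \<open>b\<close>.\<close>

lemma nth_extension:
  assumes "x \<in> words n" "i < Suc n"
  shows "(x @ [sum_list x + b]) ! i = par x ! i + (if i = n then b else 0)"
  using assms by (auto simp: par_def words_def nth_append less_Suc_eq simp del: add_bit_eq_xor)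

lemma not_reducible_punctured_code:
  assumes "2 \<le> m"
  shows "\<not> reducible n (punctured_code n m 0)"
proof
  assume "reducible n (punctured_code n m 0)"
  then obtain b where "ext_reducible (Suc n) (extension b (punctured_code n m 0))"
    unfolding reducible_def by auto
  then obtain i j c where ij: "i < Suc n" "j < Suc n" "i \<noteq> j"
    and c: "\<And>w. w \<in> extension b (punctured_code n m 0) \<Longrightarrow> w ! i + w ! j = c"
    using ext_reducible_dependent_coords by blast
  \<comment> \<open>The contribution of the check bit \<open>b\<close> to the sum of coordinates
    \<open>i\<close> and \<open>j\<close>; it is the same for all words, so the sum stays constant
    on \<open>class_code m 0\<close>.\<close>
  obtain d where d: "d = (if i = n then b else 0) + (if j = n then b else 0)" by blast
  have "y ! i + y ! j = c - d" if "y \<in> class_code m 0" for y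
  proof -
    obtain x where x: "x \<in> punctured_code n m 0" "y = par x"
      using \<open>y \<in> class_code m 0\<close> par_punctured_code by blast
    then have "(x @ [sum_list x + b]) ! i + (x @ [sum_list x + b]) ! j = c"
      by (intro c) (auto simp: extension_def)
    then have "y ! i + y ! j + d = c"
      using nth_extension[of x _ b] ij x d
      by (simp add: punctured_code_def ac_simps del: add_bit_eq_xor)
    then show ?thesis by (simp only: eq_diff_eq)
  qed
  then show False
    using class_code_separates[of m i j] assms ij n by metis
qed

lemma punctured_code_nonempty:
  assumes "0 < m"
  shows "punctured_code n m 0 \<noteq> {}"
proof -
  obtain v where "balanced v" using that[of "(0, 0, 1, 1)"] by simp
  then have "class_code m 0 \<noteq> {}"
    using ex_class_code[of 0 m 0 "\<lambda>_. v"] assms by auto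
  then show ?thesis using par_punctured_code[of 0] by auto
qed

end

theorem mainTheorem1:
  fixes n :: nat
  assumes "n \<ge> 7" and "n mod 4 = 3"
  shows "\<exists>M. mobile n M \<and> \<not> reducible n M \<and> indivisible n M"
proof -
  define m where "m = Suc n div 4"
  \<comment> \<open>The congruence makes n + 1 a multiple of the block length, and
    \<open>n \<ge> 7\<close> provides two blocks.\<close>
  have m: "Suc n = 4 * m" "2 \<le> m" using assms unfolding m_def by presburger+
  show ?thesis
    using mobile_punctured_code[OF m(1)] not_reducible_punctured_code[OF m]
      not_divisible_punctured_code[OF m] punctured_code_nonempty[OF m(1)] m(2)
    unfolding indivisible_def by auto
qed

end
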